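(* For any $\alpha\in(0,1)\setminus\{1/2\}$ and any $p,q>0$ there exist positive definite $2\times2$ matrices $A,B$ such that $\widetilde{SG}_{\alpha,p}(A,B)\not\le_{\mathrm{near}}\mathcal{A}_{\alpha,q}(A,B)$. Hence, for any $\alpha\in(0,1)$ and any $p,q>0$ there exist positive definite $2\times2$ matrices $A,B$ such that $\widetilde{SG}_{\alpha,p}(A,B)\not\le_{\mathrm{chao}}\mathcal{A}_{\alpha,q}(A,B)$.
   Context: For positive definite $A,B$: $A\#_\alpha B:=A^{1/2}(A^{-1/2}BA^{-1/2})^\alpha A^{1/2}$, $\#:=\#_{1/2}$; $\widetilde F_\alpha(A,B):=(A^{-1}\#_\alpha B)^{1/2}A^{2(1-\alpha)}(A^{-1}\#_\alpha B)^{1/2}$; $\widetilde{SG}_{\alpha,p}(A,B):=\widetilde F_\alpha(A^p,B^p)^{1/p}$; $\mathcal{A}_{\alpha,q}(A,B):=((1-\alpha)A^q+\alpha B^q)^{1/q}$. For positive definite $X,Y$: $X\le_{\mathrm{chao}}Y$ means $\log X\le\log Y$ (Loewner order); $X\le_{\mathrm{near}}Y$ means $X\#Y^{-1}\le I$. *)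

theory Defs
  imports "HOL-Analysis.Analysis"
begin

definition cadj :: "complex^'n^'m \<Rightarrow> complex^'m^'n" where
  "cadj A = (\<chi> i j. cnj (A $ j $ i))"

definition hermitian :: "complex^'n^'n \<Rightarrow> bool" where
  "hermitian A \<longleftrightarrow> cadj A = A"

definition unitary :: "complex^'n^'n \<Rightarrow> bool" where
  "unitary U \<longleftrightarrow> cadj U ** U = mat 1"

definition qform :: "complex^'n^'n \<Rightarrow> complex^'n \<Rightarrow> complex" where
  "qform A v = (\<Sum>i\<in>UNIV. cnj (v $ i) * (A *v v) $ i)"

definition posdef :: "complex^'n^'n \<Rightarrow> bool" where
  "posdef A \<longleftrightarrow> hermitian A \<and> (\<forall>v. v \<noteq> 0 \<longrightarrow> Re (qform A v) > 0)"

definition possemidef :: "complex^'n^'n \<Rightarrow> bool" where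
  "possemidef A \<longleftrightarrow> hermitian A \<and> (\<forall>v. Re (qform A v) \<ge> 0)"

definition loewner_le :: "complex^'n^'n \<Rightarrow> complex^'n^'n \<Rightarrow> bool" where
  "loewner_le X Y \<longleftrightarrow> possemidef (Y - X)"

definition rdiag :: "('n \<Rightarrow> real) \<Rightarrow> complex^'n^'n" where
  "rdiag d = (\<chi> i j. if i = j then complex_of_real (d i) else 0)"

definition mfun :: "(real \<Rightarrow> real) \<Rightarrow> complex^'n^'n \<Rightarrow> complex^'n^'n" where
  "mfun f A = (SOME M. \<exists>U d. unitary U \<and> A = U ** rdiag d ** cadj U
                          \<and> M = U ** rdiag (f \<circ> d) ** cadj U)"

definition mpow :: "complex^'n^'n \<Rightarrow> real \<Rightarrow> complex^'n^'n" where
  "mpow A r = mfun (\<lambda>x. x powr r) A"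

definition mlog :: "complex^'n^'n \<Rightarrow> complex^'n^'n" where
  "mlog A = mfun ln A"

definition gmean :: "real \<Rightarrow> complex^'n^'n \<Rightarrow> complex^'n^'n \<Rightarrow> complex^'n^'n" where
  "gmean \<alpha> A B = mpow A (1/2) ** mpow (mpow A (-1/2) ** B ** mpow A (-1/2)) \<alpha> ** mpow A (1/2)"

definition Ftilde :: "real \<Rightarrow> complex^'n^'n \<Rightarrow> complex^'n^'n \<Rightarrow> complex^'n^'n" where
  "Ftilde \<alpha> A B = mpow (gmean \<alpha> (matrix_inv A) B) (1/2) ** mpow A (2 * (1 - \<alpha>))
                   ** mpow (gmean \<alpha> (matrix_inv A) B) (1/2)"

definition SGtilde :: "real \<Rightarrow> real \<Rightarrow> complex^'n^'n \<Rightarrow> complex^'n^'n \<Rightarrow> complex^'n^'n" where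
  "SGtilde \<alpha> p A B = mpow (Ftilde \<alpha> (mpow A p) (mpow B p)) (1/p)"

definition Amean :: "real \<Rightarrow> real \<Rightarrow> complex^'n^'n \<Rightarrow> complex^'n^'n \<Rightarrow> complex^'n^'n" where
  "Amean \<alpha> q A B = mpow ((1 - \<alpha>) *\<^sub>R mpow A q + \<alpha> *\<^sub>R mpow B q) (1/q)"

definition chao_le :: "complex^'n^'n \<Rightarrow> complex^'n^'n \<Rightarrow> bool" where
  "chao_le X Y \<longleftrightarrow> loewner_le (mlog X) (mlog Y)"

definition near_le :: "complex^'n^'n \<Rightarrow> complex^'n^'n \<Rightarrow> bool" where
  "near_le X Y \<longleftrightarrow> loewner_le (gmean (1/2) X (matrix_inv Y)) (mat 1)"

end

theory Submission
  imports Defs "HOL-Real_Asymp.Real_Asymp"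
begin

text \<open>For \<open>\<alpha> \<noteq> 1/2\<close> perturb a commuting pair: \<open>A = diag(c, 1)\<close>, and \<open>B\<close> equals \<open>A\<close> plus a small
  off-diagonal entry \<open>t\<close>. At \<open>t = 0\<close> both means equal \<open>A\<close>, and their diagonals stay constant to first
  order, so either order can persist for small \<open>t\<close> of both signs only if the off-diagonal
  derivatives agree. That derivative is \<open>\<alpha>\<close> for the quasi-arithmetic mean, while for the spectral
  geometric mean it tends to 0 or 1 as \<open>c \<rightarrow> 0\<close>.

  For \<open>\<alpha> = 1/2\<close> these derivatives do agree. Here the pair is parametrised so that the spectral
  geometric mean is prescribed: \<open>A\<^sup>p = V\<^sup>-\<^sup>1 F V\<^sup>-\<^sup>1\<close> and \<open>B\<^sup>p = V F V\<close> give \<open>SG\<^sup>p = F\<close>. Take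
  \<open>F = diag(1, \<epsilon>)\<close>, so that \<open>\<langle>e\<^sub>1, log SG e\<^sub>1\<rangle> = 0\<close>. As \<open>\<epsilon> \<rightarrow> 0\<close> the powers of \<open>A\<close> and \<open>B\<close> become
  rank one, and rescaling \<open>V\<close> makes \<open>\<langle>e\<^sub>1, log \<A>\<^sub>q e\<^sub>1\<rangle>\<close> negative.\<close>

section \<open>Functional calculus of real symmetric matrices of size two\<close>

lemma matrix_inv_eq:
  fixes A B :: "complex^'n^'n"
  assumes "A ** B = mat 1"
  shows "matrix_inv A = B"
proof -
  have BA: "B ** A = mat 1"
    using assms by (simp add: matrix_left_right_inverse)
  have "\<exists>B. A ** B = mat 1 \<and> B ** A = mat 1"
    using assms BA by blast
  then have "A ** matrix_inv A = mat 1 \<and> matrix_inv A ** A = mat 1"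
    unfolding matrix_inv_def by (rule someI_ex)
  then have "matrix_inv A = (B ** A) ** matrix_inv A"
    using BA by simp
  also have "\<dots> = B ** (A ** matrix_inv A)"
    by (simp add: matrix_mul_assoc)
  finally show ?thesis
    using \<open>A ** matrix_inv A = mat 1 \<and> _\<close> by simp
qed

lemma unitary_right: "unitary U \<Longrightarrow> U ** cadj U = mat 1"
  by (simp add: unitary_def matrix_left_right_inverse)

lemma mult_rdiag_nth: "(A ** rdiag d) $ i $ j = A $ i $ j * of_real (d j)"
  by (simp add: matrix_matrix_mult_def rdiag_def if_distrib cong: if_cong)

lemma rdiag_mult_nth: "(rdiag d ** A) $ i $ j = of_real (d i) * A $ i $ j"
  by (simp add: matrix_matrix_mult_def rdiag_def if_distrib[of "\<lambda>x. x * _"] cong: if_cong)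

text \<open>The unitary connecting two diagonalisations of a matrix intertwines the two diagonals,
  hence also their images under \<open>f\<close>.\<close>

lemma mfun_spectral:
  fixes U :: "complex^'n^'n"
  assumes "unitary U"
  shows "mfun f (U ** rdiag d ** cadj U) = U ** rdiag (f \<circ> d) ** cadj U"
  unfolding mfun_def
proof (rule some_equality)
  show "\<exists>V e. unitary V \<and> U ** rdiag d ** cadj U = V ** rdiag e ** cadj V
      \<and> U ** rdiag (f \<circ> d) ** cadj U = V ** rdiag (f \<circ> e) ** cadj V"
    using assms by blast
next
  fix M
  assume "\<exists>V e. unitary V \<and> U ** rdiag d ** cadj U = V ** rdiag e ** cadj V
      \<and> M = V ** rdiag (f \<circ> e) ** cadj V"
  then obtain V e where V: "unitary V"
    and eq: "U ** rdiag d ** cadj U = V ** rdiag e ** cadj V"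
    and M: "M = V ** rdiag (f \<circ> e) ** cadj V" by blast
  define T where "T = cadj V ** U"
  have "cadj V ** (U ** rdiag d ** cadj U) ** U = T ** rdiag d ** (cadj U ** U)"
    by (simp add: T_def matrix_mul_assoc)
  moreover have "cadj V ** (V ** rdiag e ** cadj V) ** U = (cadj V ** V) ** rdiag e ** T"
    by (simp add: T_def matrix_mul_assoc)
  ultimately have TD: "T ** rdiag d = rdiag e ** T"
    using eq assms V by (simp add: unitary_def)
  have "T ** rdiag (f \<circ> d) = rdiag (f \<circ> e) ** T"
  proof -
    have "T $ i $ j * of_real (f (d j)) = of_real (f (e i)) * T $ i $ j" for i j
    proof -
      have "T $ i $ j * of_real (d j) = of_real (e i) * T $ i $ j"
        using TD by (metis mult_rdiag_nth rdiag_mult_nth)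
      then show ?thesis by (cases "T $ i $ j = 0") auto
    qed
    then show ?thesis by (simp add: vec_eq_iff mult_rdiag_nth rdiag_mult_nth)
  qed
  then have "V ** (T ** rdiag (f \<circ> d)) ** cadj U = V ** (rdiag (f \<circ> e) ** T) ** cadj U"
    by simp
  moreover have "V ** (T ** rdiag (f \<circ> d)) ** cadj U = (V ** cadj V) ** U ** rdiag (f \<circ> d) ** cadj U"
    by (simp add: T_def matrix_mul_assoc)
  moreover have "V ** (rdiag (f \<circ> e) ** T) ** cadj U = V ** rdiag (f \<circ> e) ** cadj V ** (U ** cadj U)"
    by (simp add: T_def matrix_mul_assoc)
  ultimately show "M = U ** rdiag (f \<circ> d) ** cadj U"
    using M V assms by (simp add: unitary_right)
qed

definition sm :: "real \<Rightarrow> real \<Rightarrow> real \<Rightarrow> complex^2^2" where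
  "sm x y z = (\<chi> i j. of_real (if i = j then (if i = 1 then x else z) else y))"

lemma sm_nth [simp]:
  "sm x y z $ 1 $ 1 = of_real x" "sm x y z $ 1 $ 2 = of_real y"
  "sm x y z $ 2 $ 1 = of_real y" "sm x y z $ 2 $ 2 = of_real z"
  by (simp_all add: sm_def)

lemma sm_inject [simp]: "sm x y z = sm x' y' z' \<longleftrightarrow> x = x' \<and> y = y' \<and> z = z'"
  by (auto simp: vec_eq_iff forall_2)

lemma sm_sandwich:
  "sm x y z ** sm a b c ** sm x y z =
   sm (x * x * a + 2 * x * y * b + y * y * c) (x * y * a + (x * z + y * y) * b + y * z * c)
      (y * y * a + 2 * y * z * b + z * z * c)"
  by (simp add: vec_eq_iff forall_2 matrix_matrix_mult_def sum_2 algebra_simps)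

lemma sm_linear: "r *\<^sub>R sm x y z + s *\<^sub>R sm a b c = sm (r * x + s * a) (r * y + s * b) (r * z + s * c)"
  by (simp add: vec_eq_iff forall_2 scaleR_conv_of_real[where 'a=complex])

lemma mat_1_sm: "mat 1 = sm 1 0 1"
  by (simp add: vec_eq_iff forall_2 mat_def)

lemma hermitian_sm: "hermitian (sm x y z)"
  by (simp add: hermitian_def cadj_def vec_eq_iff forall_2)

definition rotation2 :: "real \<Rightarrow> complex^2^2" where
  "rotation2 t = (\<chi> i j. of_real (if i = j then cos t else if i = 1 then - sin t else sin t))"

lemma rotation2_nth [simp]:
  "rotation2 t $ 1 $ 1 = of_real (cos t)" "rotation2 t $ 1 $ 2 = - of_real (sin t)"
  "rotation2 t $ 2 $ 1 = of_real (sin t)" "rotation2 t $ 2 $ 2 = of_real (cos t)"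
  by (simp_all add: rotation2_def)

lemma unitary_rotation2: "unitary (rotation2 t)"
proof -
  have "complex_of_real (cos t) * complex_of_real (cos t)
      + complex_of_real (sin t) * complex_of_real (sin t) = 1"
    by (metis of_real_1 of_real_add of_real_mult power2_eq_square sin_cos_squared_add2)
  then show ?thesis
    by (simp add: unitary_def vec_eq_iff forall_2 mat_def cadj_def matrix_matrix_mult_def sum_2
        algebra_simps)
qed

lemma rotation2_diag:
  "rotation2 t ** rdiag d ** cadj (rotation2 t) =
   sm ((d 1 + d 2) / 2 + (d 1 - d 2) / 2 * cos (2 * t)) ((d 1 - d 2) / 2 * sin (2 * t))
      ((d 1 + d 2) / 2 - (d 1 - d 2) / 2 * cos (2 * t))"
proof -
  have s: "sin t * sin t = 1 - cos t * cos t"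
    by (metis add_diff_cancel_left' power2_eq_square sin_cos_squared_add2)
  have "cos t * cos t * d 1 + sin t * sin t * d 2
      = (d 1 + d 2) / 2 + (d 1 - d 2) / 2 * cos (2 * t)"
    "cos t * sin t * d 1 - sin t * cos t * d 2 = (d 1 - d 2) / 2 * sin (2 * t)"
    "sin t * sin t * d 1 + cos t * cos t * d 2
      = (d 1 + d 2) / 2 - (d 1 - d 2) / 2 * cos (2 * t)"
    unfolding cos_double sin_double power2_eq_square s by (simp_all add: field_simps)
  moreover have "rotation2 t ** rdiag d ** cadj (rotation2 t) =
      sm (cos t * cos t * d 1 + sin t * sin t * d 2) (cos t * sin t * d 1 - sin t * cos t * d 2)
         (sin t * sin t * d 1 + cos t * cos t * d 2)"
    by (simp add: vec_eq_iff forall_2 cadj_def matrix_matrix_mult_def sum_2 rdiag_def)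
  ultimately show ?thesis by simp
qed

definition egap :: "real \<Rightarrow> real \<Rightarrow> real \<Rightarrow> real" where
  "egap x y z = sqrt (((x - z) / 2)\<^sup>2 + y\<^sup>2)"

abbreviation ehi :: "real \<Rightarrow> real \<Rightarrow> real \<Rightarrow> real" where
  "ehi x y z \<equiv> (x + z) / 2 + egap x y z"

abbreviation elo :: "real \<Rightarrow> real \<Rightarrow> real \<Rightarrow> real" where
  "elo x y z \<equiv> (x + z) / 2 - egap x y z"

lemma sm_spectral:
  obtains t where
    "sm x y z =
      rotation2 t ** rdiag (\<lambda>i. if i = 1 then ehi x y z else elo x y z) ** cadj (rotation2 t)"
    "(x - z) / 2 = egap x y z * cos (2 * t)" "y = egap x y z * sin (2 * t)"
proof -
  obtain r a where ra: "(x - z) / 2 = r * cos a" "y = r * sin a" "r \<ge> 0"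
  proof (cases "egap x y z = 0")
    case True
    then have "(x - z) / 2 = 0" "y = 0"
      by (auto simp: egap_def sum_power2_eq_zero_iff)
    then show ?thesis using that[of 0 0] by simp
  next
    case False
    have "((x - z) / 2)\<^sup>2 + y\<^sup>2 = (egap x y z)\<^sup>2"
      by (simp add: egap_def)
    then have "((x - z) / 2 / egap x y z)\<^sup>2 + (y / egap x y z)\<^sup>2 = 1"
      using False unfolding power_divide[of _ "egap x y z"] by (simp flip: add_divide_distrib)
    then obtain a where "(x - z) / 2 / egap x y z = cos a" "y / egap x y z = sin a"
      using sincos_total_2pi by metis
    then show ?thesis using that[of "egap x y z" a] False
      by (simp add: field_simps egap_def)
  qed
  have "((x - z) / 2)\<^sup>2 + y\<^sup>2 = r\<^sup>2"
    unfolding ra by (simp add: power_mult_distrib flip: distrib_left)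
  then have r: "egap x y z = r" using ra(3) by (simp add: egap_def)
  show ?thesis
  proof (rule that[of "a / 2"])
    show "sm x y z = rotation2 (a / 2) **
        rdiag (\<lambda>i. if i = 1 then ehi x y z else elo x y z) ** cadj (rotation2 (a / 2))"
      using ra(1,2) unfolding r by (simp add: rotation2_diag) (simp add: field_simps)
  qed (use ra r in auto)
qed

text \<open>If \<^term>\<open>egap x y z = 0\<close>, division by zero makes \<open>\<kappa>\<close> vanish, so the formula also covers
  scalar matrices.\<close>

lemma mfun_sm:
  fixes f :: "real \<Rightarrow> real" and x y z :: real
  defines "\<mu> \<equiv> (f (ehi x y z) + f (elo x y z)) / 2"
    and "\<kappa> \<equiv> (f (ehi x y z) - f (elo x y z)) / (2 * egap x y z)"
  shows "mfun f (sm x y z) = sm (\<mu> + \<kappa> * ((x - z) / 2)) (\<kappa> * y) (\<mu> - \<kappa> * ((x - z) / 2))"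
proof -
  define d :: "2 \<Rightarrow> real" where "d = (\<lambda>i. if i = 1 then ehi x y z else elo x y z)"
  obtain t where t: "sm x y z = rotation2 t ** rdiag d ** cadj (rotation2 t)"
    and c: "(x - z) / 2 = egap x y z * cos (2 * t)" and s: "y = egap x y z * sin (2 * t)"
    unfolding d_def by (rule sm_spectral)
  have d: "d 1 = ehi x y z" "d 2 = elo x y z" by (simp_all add: d_def)
  have "mfun f (sm x y z) = rotation2 t ** rdiag (f \<circ> d) ** cadj (rotation2 t)"
    unfolding t by (rule mfun_spectral[OF unitary_rotation2])
  moreover have \<kappa>: "\<kappa> * egap x y z = (f (d 1) - f (d 2)) / 2"
    by (cases "egap x y z = 0") (simp_all add: \<kappa>_def d)
  then have "\<kappa> * ((x - z) / 2) = (f (d 1) - f (d 2)) / 2 * cos (2 * t)"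
    by (metis c mult.assoc)
  moreover have "\<kappa> * y = (f (d 1) - f (d 2)) / 2 * sin (2 * t)"
    using \<kappa> by (metis s mult.assoc)
  ultimately show ?thesis
    by (simp add: rotation2_diag \<mu>_def d)
qed

lemma mfun_sm_diag: "mfun f (sm x 0 z) = sm (f x) 0 (f z)"
  using mfun_spectral[OF unitary_rotation2, of f 0 "\<lambda>i. if i = 1 then x else z"]
  by (simp add: rotation2_diag field_simps)

section \<open>Positive definite matrices\<close>

lemma qform_sm:
  "Re (qform (sm x y z) v) =
    x * (cmod (v $ 1))\<^sup>2 + 2 * y * Re (cnj (v $ 1) * v $ 2) + z * (cmod (v $ 2))\<^sup>2"
  by (simp add: qform_def sum_2 matrix_vector_mult_def cmod_power2)
    (simp add: power2_eq_square algebra_simps)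

lemma possemidef_smD:
  assumes "possemidef (sm x y z)"
  shows "x \<ge> 0" "x + 2 * y + z \<ge> 0"
proof -
  have q: "Re (qform (sm x y z) v) \<ge> 0" for v
    using assms by (simp add: possemidef_def)
  show "x \<ge> 0" using q[of "\<chi> i. if i = 1 then 1 else 0"] by (simp add: qform_sm)
  show "x + 2 * y + z \<ge> 0" using q[of "\<chi> i. 1"] by (simp add: qform_sm)
qed

definition spd :: "complex^2^2 \<Rightarrow> bool" where
  "spd M \<longleftrightarrow> (\<exists>x y z. M = sm x y z \<and> 0 < x \<and> y\<^sup>2 < x * z)"

lemma spd_sm: "spd (sm x y z) \<longleftrightarrow> 0 < x \<and> y\<^sup>2 < x * z"
  by (auto simp: spd_def)

lemma spd_smI: "0 < x + z \<Longrightarrow> y\<^sup>2 < x * z \<Longrightarrow> spd (sm x y z)"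
proof -
  assume t: "0 < x + z" and d: "y\<^sup>2 < x * z"
  have "0 < x * z" using d zero_le_power2[of y] by linarith
  then show ?thesis using t d by (auto simp: spd_sm zero_less_mult_iff)
qed

lemma posdef_spd:
  assumes "spd M" shows "posdef M"
proof -
  obtain x y z where M: "M = sm x y z" and x: "0 < x" and d: "y\<^sup>2 < x * z"
    using assms by (auto simp: spd_def)
  have "0 < Re (qform M v)" if v: "v \<noteq> 0" for v
  proof -
    obtain a b where ab: "v $ 1 = Complex a b" by (metis complex.exhaust)
    obtain c e where ce: "v $ 2 = Complex c e" by (metis complex.exhaust)
    have "x * Re (qform M v) = (x * a + y * c)\<^sup>2 + (x * b + y * e)\<^sup>2 + (x * z - y\<^sup>2) * (c\<^sup>2 + e\<^sup>2)"
      unfolding M qform_sm ab ce by (simp add: cmod_power2) (simp add: power2_eq_square algebra_simps)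
    also have "\<dots> > 0"
    proof (cases "c = 0 \<and> e = 0")
      case True
      then have "a \<noteq> 0 \<or> b \<noteq> 0"
        using v ab ce by (auto simp: vec_eq_iff forall_2 Complex_eq_0)
      then have "0 < (x * a)\<^sup>2 + (x * b)\<^sup>2"
        using x by (simp add: sum_power2_gt_zero_iff)
      then show ?thesis using True by simp
    next
      case False
      then have "0 < c\<^sup>2 + e\<^sup>2" by (simp add: sum_power2_gt_zero_iff)
      then have "0 < (x * z - y\<^sup>2) * (c\<^sup>2 + e\<^sup>2)" using d by simp
      then show ?thesis by (intro add_nonneg_pos) auto
    qed
    finally show ?thesis using x by (simp add: zero_less_mult_iff)
  qed
  then show ?thesis by (simp add: posdef_def M hermitian_sm)
qed

lemma egap_power2: "(egap x y z)\<^sup>2 = ((x - z) / 2)\<^sup>2 + y\<^sup>2"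
  by (simp add: egap_def)

lemma ehi_elo_pos:
  assumes "0 < x" "y\<^sup>2 < x * z"
  shows "0 < ehi x y z" "0 < elo x y z"
proof -
  have "0 < x * z" using assms(2) zero_le_power2[of y] by linarith
  then have t: "0 < (x + z) / 2" using assms(1) by (simp add: zero_less_mult_iff)
  have "((x + z) / 2)\<^sup>2 - (egap x y z)\<^sup>2 = x * z - y\<^sup>2"
    unfolding egap_power2 by (simp add: power2_eq_square field_simps)
  then have "(egap x y z)\<^sup>2 < ((x + z) / 2)\<^sup>2"
    using assms(2) by linarith
  then have "egap x y z < (x + z) / 2"
    by (rule power2_less_imp_less) (use t in linarith)
  then show "0 < elo x y z" by linarith
  have "0 \<le> egap x y z" unfolding egap_def by (rule real_sqrt_ge_zero) simp
  then show "0 < ehi x y z" using t by linarith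
qed

lemma mfun_cong:
  assumes "spd M" "\<And>t. 0 < t \<Longrightarrow> f t = g t"
  shows "mfun f M = mfun g M"
proof -
  obtain x y z where M: "M = sm x y z" "0 < x" "y\<^sup>2 < x * z"
    using assms(1) by (auto simp: spd_def)
  have "f (ehi x y z) = g (ehi x y z)" "f (elo x y z) = g (elo x y z)"
    by (rule assms(2)[OF ehi_elo_pos(1)[OF M(2,3)]], rule assms(2)[OF ehi_elo_pos(2)[OF M(2,3)]])
  then show ?thesis by (simp add: M mfun_sm)
qed

lemma mfun_mfun_sm: "mfun g (mfun f (sm x y z)) = mfun (\<lambda>t. g (f t)) (sm x y z)"
proof -
  obtain t where t: "sm x y z =
      rotation2 t ** rdiag (\<lambda>i. if i = 1 then ehi x y z else elo x y z) ** cadj (rotation2 t)"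
    by (rule sm_spectral)
  show ?thesis
    unfolding t mfun_spectral[OF unitary_rotation2] by (simp add: comp_def)
qed

lemma rdiag_mult: "rdiag d ** rdiag e = rdiag (\<lambda>i. d i * e i)"
  by (simp add: vec_eq_iff mult_rdiag_nth) (simp add: rdiag_def)

lemma mfun_mult_sm: "mfun f (sm x y z) ** mfun g (sm x y z) = mfun (\<lambda>t. f t * g t) (sm x y z)"
proof -
  obtain t where t: "sm x y z =
      rotation2 t ** rdiag (\<lambda>i. if i = 1 then ehi x y z else elo x y z) ** cadj (rotation2 t)"
    by (rule sm_spectral)
  let ?U = "rotation2 t"
  have "(?U ** D ** cadj ?U) ** (?U ** E ** cadj ?U) = ?U ** (D ** E) ** cadj ?U" for D E
  proof -
    have "(?U ** D ** cadj ?U) ** (?U ** E ** cadj ?U) = ?U ** D ** (cadj ?U ** ?U) ** E ** cadj ?U"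
      by (simp add: matrix_mul_assoc)
    also have "cadj ?U ** ?U = mat 1"
      using unitary_rotation2[of t] by (simp add: unitary_def)
    finally show ?thesis by (simp add: matrix_mul_assoc)
  qed
  then show ?thesis
    unfolding t mfun_spectral[OF unitary_rotation2] by (simp add: rdiag_mult comp_def)
qed

lemma mfun_ident_sm: "mfun (\<lambda>t. t) (sm x y z) = sm x y z"
proof -
  have "egap x y z = 0 \<Longrightarrow> x = z \<and> y = 0"
    by (auto simp: egap_def sum_power2_eq_zero_iff)
  then show ?thesis by (cases "egap x y z = 0") (auto simp: mfun_sm field_simps)
qed

lemma mfun_const_sm: "mfun (\<lambda>t. c) (sm x y z) = sm c 0 c"
  by (simp add: mfun_sm)

lemma mfun_cmult_sm: "mfun (\<lambda>t. c * f t) (sm x y z) = c *\<^sub>R mfun f (sm x y z)"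
  using sm_linear[of c _ _ _ 0 0 0 0] by (simp add: mfun_sm algebra_simps)

lemma spd_mfun:
  assumes "spd M" and f: "\<And>t. 0 < t \<Longrightarrow> 0 < f t"
  shows "spd (mfun f M)"
proof -
  obtain x y z where M: "M = sm x y z" and xyz: "0 < x" "y\<^sup>2 < x * z"
    using assms by (auto simp: spd_def)
  define u v where uv: "u = f (ehi x y z)" "v = f (elo x y z)"
  have pos: "0 < u" "0 < v" using f ehi_elo_pos[OF xyz] by (auto simp: uv)
  define k where "k = (u - v) / (2 * egap x y z)"
  have "k * egap x y z = (u - v) / 2 \<or> egap x y z = 0" by (auto simp: k_def)
  moreover have "egap x y z = 0 \<Longrightarrow> u = v" by (simp add: uv)
  ultimately have "k * egap x y z = (u - v) / 2" by auto
  then have "k\<^sup>2 * (((x - z) / 2)\<^sup>2 + y\<^sup>2) = ((u - v) / 2)\<^sup>2"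
    by (metis egap_power2 power_mult_distrib)
  moreover have "0 < u * v" using pos by simp
  ultimately have "(k * y)\<^sup>2 < ((u + v) / 2 + k * ((x - z) / 2)) * ((u + v) / 2 - k * ((x - z) / 2))"
    by (simp add: power2_eq_square field_simps)
  then have "spd (sm ((u + v) / 2 + k * ((x - z) / 2)) (k * y) ((u + v) / 2 - k * ((x - z) / 2)))"
    using pos by (intro spd_smI) auto
  then show ?thesis by (simp add: M mfun_sm uv k_def)
qed

lemma spd_sandwich:
  assumes "spd S" "spd T"
  shows "spd (S ** T ** S)"
proof -
  obtain x y z where S: "S = sm x y z" and s: "0 < x" "y\<^sup>2 < x * z"
    using assms by (auto simp: spd_def)
  obtain a b c where T: "T = sm a b c" and t: "0 < a" "b\<^sup>2 < a * c"
    using assms by (auto simp: spd_def)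
  let ?p = "x * x * a + 2 * x * y * b + y * y * c"
  let ?q = "x * y * a + (x * z + y * y) * b + y * z * c"
  let ?r = "y * y * a + 2 * y * z * b + z * z * c"
  have "a * ?p = (a * x + b * y)\<^sup>2 + (a * c - b\<^sup>2) * y\<^sup>2"
    by (simp add: power2_eq_square algebra_simps)
  moreover have "0 < (a * x + b * y)\<^sup>2 + (a * c - b\<^sup>2) * y\<^sup>2"
  proof (cases "y = 0")
    case True then show ?thesis using s t by simp
  next
    case False
    then show ?thesis using t by (intro add_nonneg_pos) auto
  qed
  ultimately have "0 < a * ?p" by (simp only:)
  then have p: "0 < ?p" using t(1) by (rule zero_less_mult_pos)
  have "?p * ?r - ?q\<^sup>2 = (x * z - y\<^sup>2)\<^sup>2 * (a * c - b\<^sup>2)"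
    by algebra
  also have "\<dots> > 0" using s t by (intro mult_pos_pos zero_less_power) simp_all
  finally have "?q\<^sup>2 < ?p * ?r" by simp
  with p show ?thesis by (simp add: S T sm_sandwich spd_sm)
qed

lemma spdE:
  assumes "spd M" obtains x y z where "M = sm x y z"
  using assms by (auto simp: spd_def)

lemma spd_mpow: "spd M \<Longrightarrow> spd (mpow M s)"
  unfolding mpow_def by (rule spd_mfun) auto

lemma mpow_mult: "spd M \<Longrightarrow> mpow M s ** mpow M t = mpow M (s + t)"
  by (auto elim!: spdE simp: mpow_def mfun_mult_sm powr_add)

lemma mpow_mpow_sm: "mpow (mpow (sm x y z) s) t = mpow (sm x y z) (s * t)"
  by (simp add: mpow_def mfun_mfun_sm powr_powr)

lemma mpow_mpow: "spd M \<Longrightarrow> mpow (mpow M s) t = mpow M (s * t)"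
  by (auto elim!: spdE simp: mpow_mpow_sm)

lemma mpow_1: "spd M \<Longrightarrow> mpow M 1 = M"
  unfolding mpow_def by (subst mfun_cong[where g = "\<lambda>t. t"]) (auto elim!: spdE simp: mfun_ident_sm)

lemma mpow_0: "spd M \<Longrightarrow> mpow M 0 = mat 1"
  unfolding mpow_def
  by (subst mfun_cong[where g = "\<lambda>t. 1"]) (auto elim!: spdE simp: mfun_const_sm mat_1_sm)

lemma mlog_mpow_sm: "mlog (mpow (sm x y z) s) = s *\<^sub>R mlog (sm x y z)"
  by (simp add: mpow_def mlog_def mfun_mfun_sm mfun_cmult_sm)

lemma matrix_inv_spd: "spd M \<Longrightarrow> matrix_inv M = mpow M (-1)"
  using mpow_mult[of M 1 "-1"] by (intro matrix_inv_eq) (simp add: mpow_1 mpow_0)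

lemma Ftilde_half:
  assumes A: "spd A" and V: "spd V"
  shows "Ftilde (1/2) A (V ** V ** A ** V ** V) = V ** A ** V"
proof -
  define P Q where "P = mpow A (-1/2)" and "Q = mpow A (1/2)"
  have PQ: "P ** Q = mat 1" "Q ** P = mat 1" and QQ: "Q ** Q = A"
    using A by (simp_all add: P_def Q_def mpow_mult mpow_0 mpow_1)
  have root: "mpow (M ** M) (1/2) = M" if "spd M" for M
  proof -
    have "M ** M = mpow M 2" using that mpow_mult[of M 1 1] by (simp add: mpow_1)
    then show ?thesis using that by (simp add: mpow_mpow mpow_1)
  qed
  have "V ** V = V ** mpow V 0 ** V" using V by (simp add: mpow_0)
  then have VV: "spd (V ** V)" using V by (metis spd_mpow spd_sandwich)
  have Q: "spd Q" using A by (simp add: Q_def spd_mpow)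
  have "Q ** (V ** V ** A ** V ** V) ** Q = (Q ** (V ** V) ** Q) ** (Q ** (V ** V) ** Q)"
    by (simp add: matrix_mul_assoc flip: QQ)
  then have "mpow (Q ** (V ** V ** A ** V ** V) ** Q) (1/2) = Q ** (V ** V) ** Q"
    using root[OF spd_sandwich[OF Q VV]] by simp
  moreover have "mpow (matrix_inv A) (1/2) = P" "mpow (matrix_inv A) (-1/2) = Q"
    using A by (simp_all add: matrix_inv_spd mpow_mpow P_def Q_def)
  ultimately have "gmean (1/2) (matrix_inv A) (V ** V ** A ** V ** V) = P ** (Q ** (V ** V) ** Q) ** P"
    unfolding gmean_def by simp
  also have "\<dots> = (P ** Q) ** (V ** V) ** (Q ** P)"
    by (simp add: matrix_mul_assoc)
  finally have "gmean (1/2) (matrix_inv A) (V ** V ** A ** V ** V) = V ** V"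
    by (simp add: PQ)
  then show ?thesis
    using A V by (simp add: Ftilde_def root mpow_1)
qed

section \<open>First-order perturbations\<close>

text \<open>The family \<open>M\<close> has diagonal \<open>d, e\<close> up to \<open>o(t)\<close> and off-diagonal entry \<open>k t + o(t)\<close>. All families of the
  perturbation argument are diagonal at \<open>t = 0\<close> with purely off-diagonal derivative, and this class is
  stable under functional calculus as long as \<open>d \<noteq> e\<close>.\<close>

definition jet :: "(real \<Rightarrow> complex^2^2) \<Rightarrow> real \<Rightarrow> real \<Rightarrow> real \<Rightarrow> bool" where
  "jet M d k e \<longleftrightarrow> (\<exists>x y z. (\<forall>\<^sub>F t in nhds 0. M t = sm (x t) (y t) (z t))
      \<and> x 0 = d \<and> y 0 = 0 \<and> z 0 = e \<and> (x has_real_derivative 0) (at 0)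
      \<and> (y has_real_derivative k) (at 0) \<and> (z has_real_derivative 0) (at 0))"

lemma jetI:
  assumes "\<forall>\<^sub>F t in nhds 0. M t = sm (x t) (y t) (z t)" "x 0 = d" "y 0 = 0" "z 0 = e"
    "(x has_real_derivative 0) (at 0)" "(y has_real_derivative k) (at 0)"
    "(z has_real_derivative 0) (at 0)"
  shows "jet M d k e"
  using assms unfolding jet_def by blast

lemma jetE:
  assumes "jet M d k e"
  obtains x y z where "\<forall>\<^sub>F t in nhds 0. M t = sm (x t) (y t) (z t)" "x 0 = d" "y 0 = 0" "z 0 = e"
    "(x has_real_derivative 0) (at 0)" "(y has_real_derivative k) (at 0)"
    "(z has_real_derivative 0) (at 0)"
  using assms unfolding jet_def by blast

lemma jet_cong:
  assumes "jet M d k e" "\<forall>\<^sub>F t in nhds 0. N t = M t"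
  shows "jet N d k e"
proof -
  obtain x y z where *: "\<forall>\<^sub>F t in nhds 0. M t = sm (x t) (y t) (z t)" "x 0 = d" "y 0 = 0" "z 0 = e"
    "(x has_real_derivative 0) (at 0)" "(y has_real_derivative k) (at 0)"
    "(z has_real_derivative 0) (at 0)"
    using assms(1) by (rule jetE)
  have "\<forall>\<^sub>F t in nhds 0. N t = sm (x t) (y t) (z t)"
    using *(1) assms(2) by eventually_elim simp
  then show ?thesis using *(2-) by (rule jetI)
qed

lemma jet_eq: "jet M d k e \<Longrightarrow> d = d' \<Longrightarrow> k = k' \<Longrightarrow> e = e' \<Longrightarrow> jet M d' k' e'"
  by simp

lemma jet_const: "jet (\<lambda>t. sm d 0 e) d 0 e"
  by (rule jetI[where x = "\<lambda>_. d" and y = "\<lambda>_. 0" and z = "\<lambda>_. e"]) auto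

lemma jet_offdiag: "jet (\<lambda>t. sm d t e) d 1 e"
  by (rule jetI[where x = "\<lambda>_. d" and y = "\<lambda>t. t" and z = "\<lambda>_. e"]) auto

lemma jet_linear:
  assumes "jet M d k e" "jet N d' k' e'"
  shows "jet (\<lambda>t. r *\<^sub>R M t + s *\<^sub>R N t) (r * d + s * d') (r * k + s * k') (r * e + s * e')"
proof -
  obtain x y z where M: "\<forall>\<^sub>F t in nhds 0. M t = sm (x t) (y t) (z t)" "x 0 = d" "y 0 = 0" "z 0 = e"
    "(x has_real_derivative 0) (at 0)" "(y has_real_derivative k) (at 0)"
    "(z has_real_derivative 0) (at 0)"
    using assms(1) by (rule jetE)
  obtain a b c where N: "\<forall>\<^sub>F t in nhds 0. N t = sm (a t) (b t) (c t)" "a 0 = d'" "b 0 = 0" "c 0 = e'"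
    "(a has_real_derivative 0) (at 0)" "(b has_real_derivative k') (at 0)"
    "(c has_real_derivative 0) (at 0)"
    using assms(2) by (rule jetE)
  show ?thesis
  proof (rule jetI)
    show "\<forall>\<^sub>F t in nhds 0. r *\<^sub>R M t + s *\<^sub>R N t =
        sm (r * x t + s * a t) (r * y t + s * b t) (r * z t + s * c t)"
      using M(1) N(1) by eventually_elim (simp add: sm_linear)
  qed (use M(2-4) N(2-4) in \<open>auto intro!: derivative_eq_intros M(5-7) N(5-7)\<close>)
qed

lemma jet_sandwich:
  assumes "jet M d k e" "jet N d' k' e'"
  shows "jet (\<lambda>t. M t ** N t ** M t) (d * d * d') (d * k * d' + d * e * k' + k * e * e') (e * e * e')"
proof -
  obtain x y z where M: "\<forall>\<^sub>F t in nhds 0. M t = sm (x t) (y t) (z t)" "x 0 = d" "y 0 = 0" "z 0 = e"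
    "(x has_real_derivative 0) (at 0)" "(y has_real_derivative k) (at 0)"
    "(z has_real_derivative 0) (at 0)"
    using assms(1) by (rule jetE)
  obtain a b c where N: "\<forall>\<^sub>F t in nhds 0. N t = sm (a t) (b t) (c t)" "a 0 = d'" "b 0 = 0" "c 0 = e'"
    "(a has_real_derivative 0) (at 0)" "(b has_real_derivative k') (at 0)"
    "(c has_real_derivative 0) (at 0)"
    using assms(2) by (rule jetE)
  show ?thesis
  proof (rule jetI)
    show "\<forall>\<^sub>F t in nhds 0. M t ** N t ** M t =
        sm (x t * x t * a t + 2 * x t * y t * b t + y t * y t * c t)
          (x t * y t * a t + (x t * z t + y t * y t) * b t + y t * z t * c t)
          (y t * y t * a t + 2 * y t * z t * b t + z t * z t * c t)"
      using M(1) N(1) by eventually_elim (simp add: sm_sandwich)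
  qed (use M(2-4) N(2-4) in \<open>auto intro!: derivative_eq_intros M(5-7) N(5-7)\<close>)
qed

lemma jet_mfun:
  fixes f :: "real \<Rightarrow> real"
  assumes "jet M d k e" and de: "d \<noteq> e"
    and fd: "(f has_real_derivative f1) (at d)" and fe: "(f has_real_derivative f2) (at e)"
  shows "jet (\<lambda>t. mfun f (M t)) (f d) (k * (f d - f e) / (d - e)) (f e)"
proof -
  obtain x y z where M: "\<forall>\<^sub>F t in nhds 0. M t = sm (x t) (y t) (z t)" "x 0 = d" "y 0 = 0" "z 0 = e"
    and D: "(x has_real_derivative 0) (at 0)" "(y has_real_derivative k) (at 0)"
    "(z has_real_derivative 0) (at 0)"
    using assms(1) by (rule jetE)
  define g where "g t = egap (x t) (y t) (z t)" for t
  define h where "h t = (x t + z t) / 2 + g t" for t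
  define l where "l t = (x t + z t) / 2 - g t" for t
  define \<mu> where "\<mu> t = (f (h t) + f (l t)) / 2" for t
  define \<kappa> where "\<kappa> t = (f (h t) - f (l t)) / (2 * g t)" for t
  have g0: "g 0 = \<bar>d - e\<bar> / 2" by (simp add: g_def egap_def M)
  have Dg: "(g has_real_derivative 0) (at 0)"
  proof -
    have "0 < ((x 0 - z 0) / 2)\<^sup>2 + (y 0)\<^sup>2" using de by (simp add: M)
    then show ?thesis
      unfolding g_def egap_def
      by (auto intro!: derivative_eq_intros D simp: M)
  qed
  have Dh: "(h has_real_derivative 0) (at 0)" and Dl: "(l has_real_derivative 0) (at 0)"
    unfolding h_def l_def by (auto intro!: derivative_eq_intros D Dg)
  have "h 0 = d \<and> l 0 = e \<or> h 0 = e \<and> l 0 = d"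
    by (cases "d < e") (auto simp: h_def l_def g0 M field_simps)
  then have hl: "\<exists>D. (f has_real_derivative D) (at (h 0))" "\<exists>D. (f has_real_derivative D) (at (l 0))"
    using fd fe by auto
  have Dfh: "((\<lambda>t. f (h t)) has_real_derivative 0) (at 0)"
    and Dfl: "((\<lambda>t. f (l t)) has_real_derivative 0) (at 0)"
    using hl DERIV_chain2[OF _ Dh] DERIV_chain2[OF _ Dl] by (metis mult_zero_right)+
  have g0': "g 0 \<noteq> 0" using de by (simp add: g0)
  have D\<mu>: "(\<mu> has_real_derivative 0) (at 0)"
    unfolding \<mu>_def by (auto intro!: derivative_eq_intros Dfh Dfl)
  have D\<kappa>: "(\<kappa> has_real_derivative 0) (at 0)"
    unfolding \<kappa>_def using g0' by (auto intro!: derivative_eq_intros Dfh Dfl Dg)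
  have \<kappa>0: "\<kappa> 0 = (f d - f e) / (d - e)" and \<mu>0: "\<mu> 0 = (f d + f e) / 2"
    using de \<open>_ \<or> _\<close> by (auto simp: \<kappa>_def \<mu>_def h_def l_def g0 M field_simps abs_if split: if_splits)
  show ?thesis
  proof (rule jetI)
    show "\<forall>\<^sub>F t in nhds 0. mfun f (M t) = sm (\<mu> t + \<kappa> t * ((x t - z t) / 2)) (\<kappa> t * y t)
        (\<mu> t - \<kappa> t * ((x t - z t) / 2))"
      using M(1) by eventually_elim (simp add: mfun_sm \<mu>_def \<kappa>_def h_def l_def g_def)
    show "\<mu> 0 + \<kappa> 0 * ((x 0 - z 0) / 2) = f d" "\<mu> 0 - \<kappa> 0 * ((x 0 - z 0) / 2) = f e"
      using de by (simp_all add: \<kappa>0 \<mu>0 M field_simps)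
    show "((\<lambda>t. \<kappa> t * y t) has_real_derivative k * (f d - f e) / (d - e)) (at 0)"
      by (auto intro!: derivative_eq_intros D\<kappa> D simp: \<kappa>0 M)
  qed (auto intro!: derivative_eq_intros D\<kappa> D\<mu> D simp: M)
qed

lemma jet_mpow:
  assumes "jet M d k 1" "0 < d" "d \<noteq> 1"
  shows "jet (\<lambda>t. mpow (M t) s) (d powr s) (k * (d powr s - 1) / (d - 1)) 1"
  using jet_mfun[OF assms(1,3) has_real_derivative_powr[OF assms(2), of s]
    has_real_derivative_powr[OF zero_less_one, of s]]
  by (simp add: mpow_def)

lemma jet_mlog:
  assumes "jet M d k 1" "0 < d" "d \<noteq> 1"
  shows "jet (\<lambda>t. mlog (M t)) (ln d) (k * ln d / (d - 1)) 0"
  using jet_mfun[OF assms(1,3) DERIV_ln DERIV_ln] assms(2) by (simp add: mlog_def)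

lemma eventually_nhds_pos:
  fixes h :: "real \<Rightarrow> real"
  assumes "isCont h 0" "0 < h 0"
  shows "\<forall>\<^sub>F t in nhds 0. 0 < h t"
  using assms by (auto simp: isCont_def tendsto_at_iff_tendsto_nhds dest: order_tendstoD)

lemma jet_spd:
  assumes "jet M d k e" "0 < d" "0 < e"
  shows "\<forall>\<^sub>F t in nhds 0. spd (M t)"
proof -
  obtain x y z where M: "\<forall>\<^sub>F t in nhds 0. M t = sm (x t) (y t) (z t)" "x 0 = d" "y 0 = 0" "z 0 = e"
    and D: "(x has_real_derivative 0) (at 0)" "(y has_real_derivative k) (at 0)"
    "(z has_real_derivative 0) (at 0)"
    using assms(1) by (rule jetE)
  have "\<forall>\<^sub>F t in nhds 0. 0 < x t"
    by (rule eventually_nhds_pos) (use assms M D in \<open>auto intro: DERIV_isCont\<close>)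
  moreover have "\<forall>\<^sub>F t in nhds 0. 0 < x t * z t - (y t)\<^sup>2"
    by (rule eventually_nhds_pos) (use assms M D in \<open>auto intro!: continuous_intros intro: DERIV_isCont\<close>)
  ultimately show ?thesis
    using M(1) by eventually_elim (simp add: spd_sm)
qed

lemma jet_possemidef:
  assumes "jet M 0 k 0" "\<forall>\<^sub>F t in nhds 0. possemidef (M t)"
  shows "k = 0"
proof -
  obtain x y z where M: "\<forall>\<^sub>F t in nhds 0. M t = sm (x t) (y t) (z t)" "x 0 = 0" "y 0 = 0" "z 0 = 0"
    and D: "(x has_real_derivative 0) (at 0)" "(y has_real_derivative k) (at 0)"
    "(z has_real_derivative 0) (at 0)"
    using assms(1) by (rule jetE)
  define h where "h t = x t + 2 * y t + z t" for t
  have Dh: "(h has_real_derivative 2 * k) (at 0)"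
    unfolding h_def by (auto intro!: derivative_eq_intros D)
  have "\<forall>\<^sub>F t in nhds 0. 0 \<le> h t"
    using M(1) assms(2) by eventually_elim (simp add: h_def possemidef_smD)
  then obtain r where "0 < r" "\<And>t. dist t 0 < r \<Longrightarrow> 0 \<le> h t"
    unfolding eventually_nhds_metric by blast
  then have "\<forall>t. \<bar>0 - t\<bar> < r \<longrightarrow> h 0 \<le> h t"
    by (simp add: h_def M dist_real_def)
  then have "2 * k = 0" using DERIV_local_min[OF Dh \<open>0 < r\<close>] by simp
  then show ?thesis by simp
qed

lemma jet_chao_le:
  assumes X: "jet X x k 1" and Y: "jet Y x l 1" and x: "0 < x" "x \<noteq> 1"
    and le: "\<forall>\<^sub>F t in nhds 0. chao_le (X t) (Y t)"
  shows "k = l"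
proof -
  have "jet (\<lambda>t. mlog (Y t) - mlog (X t)) 0 ((l - k) * ln x / (x - 1)) 0"
    using jet_linear[OF jet_mlog[OF Y x] jet_mlog[OF X x], of 1 "-1"]
    by (simp add: diff_divide_distrib left_diff_distrib)
  then have "(l - k) * ln x / (x - 1) = 0"
    by (rule jet_possemidef) (use le in \<open>simp add: chao_le_def loewner_le_def\<close>)
  then show ?thesis using x by simp
qed

lemma jet_near_le:
  assumes X: "jet X x k 1" and Y: "jet Y x l 1" and x: "0 < x" "x \<noteq> 1"
    and le: "\<forall>\<^sub>F t in nhds 0. near_le (X t) (Y t)"
  shows "k = l"
proof -
  define s where "s = sqrt x"
  have s: "0 < s" "s \<noteq> 1" and xs: "x = s * s"
    using x by (auto simp: s_def)
  have s2: "s * s \<noteq> 1" using x xs by simp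
  have sp: "0 < 1 + s" "0 < 1 + s * s" using s by (auto intro: add_pos_pos)
  have p: "(s * s) powr (1/2) = s" "(s * s) powr (-1/2) = 1 / s" "(s * s) powr (-1) = 1 / (s * s)"
    using s by (simp_all add: powr_half_sqrt powr_minus_divide flip: power2_eq_square)
  have Y': "jet (\<lambda>t. matrix_inv (Y t)) (1 / (s * s)) (- l / (s * s)) 1"
  proof (rule jet_cong[OF jet_eq[OF jet_mpow[OF Y x, of "-1"]]])
    show "\<forall>\<^sub>F t in nhds 0. matrix_inv (Y t) = mpow (Y t) (-1)"
      using jet_spd[OF Y x(1)] by (simp add: eventually_mono[OF _ matrix_inv_spd])
    show "l * (x powr - 1 - 1) / (x - 1) = - l / (s * s)"
      unfolding xs p using s s2 by (simp add: field_simps)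
  qed (use p xs in auto)
  have X1: "jet (\<lambda>t. mpow (X t) (1/2)) s (k / (1 + s)) 1"
    by (rule jet_eq[OF jet_mpow[OF X x, of "1/2"]])
      (unfold xs p, use s s2 sp in \<open>simp_all add: field_simps\<close>)
  have X2: "jet (\<lambda>t. mpow (X t) (-1/2)) (1 / s) (- k / (s * (1 + s))) 1"
  proof (rule jet_eq[OF jet_mpow[OF X x, of "-1/2"]])
    have "k * (1 / s - 1) * (s * (1 + s)) = - k * (s * s - 1)"
      using s by (simp add: field_simps)
    then show "k * (x powr (-1/2) - 1) / (x - 1) = - k / (s * (1 + s))"
      unfolding xs p using s s2 sp by (subst frac_eq_eq) auto
  qed (use p xs in auto)
  define m where "m = - (k * (1 - s + s * s) / (s * s * s * s) + l / (s * s * s))"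
  have W: "jet (\<lambda>t. mpow (X t) (-1/2) ** matrix_inv (Y t) ** mpow (X t) (-1/2)) (1 / (s * s * s * s)) m 1"
    proof (rule jet_eq[OF jet_sandwich[OF X2 Y']])
    define r where "r = k / (1 + s)"
    have k: "k = r * (1 + s)" using sp by (simp add: r_def)
    have e: "- k / (s * (1 + s)) = - r / s" using s sp by (simp add: r_def)
    show "1 / s * (- k / (s * (1 + s))) * (1 / (s * s)) + 1 / s * 1 * (- l / (s * s))
        + - k / (s * (1 + s)) * 1 * 1 = m"
      unfolding e m_def unfolding k using s by (simp add: field_simps)
  qed (use s in auto)
  have s4: "0 < 1 / (s * s * s * s)" "1 / (s * s * s * s) \<noteq> 1"
  proof -
    have "s * s * s * s - 1 = (s * s - 1) * (s * s + 1)" by (simp add: algebra_simps)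
    then show "1 / (s * s * s * s) \<noteq> 1" using s2 sp s by auto
  qed (use s in simp)
  have p4: "(1 / (s * s * s * s)) powr (1/2) = 1 / (s * s)"
    using s by (simp add: powr_half_sqrt real_sqrt_divide real_sqrt_mult)
  have R: "jet (\<lambda>t. mpow (mpow (X t) (-1/2) ** matrix_inv (Y t) ** mpow (X t) (-1/2)) (1/2))
      (1 / (s * s)) (m * (s * s) / (1 + s * s)) 1"
  proof (rule jet_eq[OF jet_mpow[OF W s4, of "1/2"]])
    show "m * ((1 / (s * s * s * s)) powr (1 / 2) - 1) / (1 / (s * s * s * s) - 1)
        = m * (s * s) / (1 + s * s)"
    proof -
      have "1 / (s * s * s * s) - 1 = (1 / (s * s) - 1) * ((1 + s * s) / (s * s))"
        using s by (simp add: field_simps)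
      moreover have "1 / (s * s) - 1 \<noteq> 0" using s s2 by (simp add: field_simps)
      ultimately show ?thesis unfolding p4 using s s2 by simp
    qed
  qed (use p4 in auto)
  have G: "jet (\<lambda>t. gmean (1/2) (X t) (matrix_inv (Y t))) 1 ((k - l) / (1 + s * s)) 1"
    unfolding gmean_def
  proof (rule jet_eq[OF jet_sandwich[OF X1 R]])
    have "k * (1 + s * s) + m * (s * s * s * s) = (k - l) * s"
      using s by (simp add: m_def field_simps)
    then have "(k - l) / (1 + s * s) = (k * (1 + s * s) + m * (s * s * s * s)) / (s * (1 + s * s))"
      using s by simp
    also have "\<dots> = k / s + m * (s * s) * s / (1 + s * s)"
      using s sp by (simp add: field_simps)
    also have "k / s = s * (k / (1 + s)) * (1 / (s * s)) + k / (1 + s)"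
    proof -
      define r where "r = k / (1 + s)"
      have k: "k = r * (1 + s)" using sp by (simp add: r_def)
      show ?thesis unfolding r_def[symmetric] using s by (simp add: k field_simps)
    qed
    finally show "s * (k / (1 + s)) * (1 / (s * s)) + s * 1 * (m * (s * s) / (1 + s * s))
        + k / (1 + s) * 1 * 1 = (k - l) / (1 + s * s)"
      by simp
  qed (use s in auto)
  have "jet (\<lambda>t. mat 1 - gmean (1/2) (X t) (matrix_inv (Y t))) 0 ((l - k) / (1 + s * s)) 0"
    using jet_linear[OF jet_const[of 1 1] G, of 1 "-1"]
    by (simp add: mat_1_sm diff_divide_distrib)
  then have "(l - k) / (1 + s * s) = 0"
    by (rule jet_possemidef) (use le in \<open>simp add: near_le_def loewner_le_def\<close>)
  then show ?thesis using sp by simp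
qed

section \<open>Failure of both orders off the midpoint\<close>

lemma matrix_inv_sm_diag: "a \<noteq> 0 \<Longrightarrow> matrix_inv (sm a 0 1) = sm (1 / a) 0 1"
  by (rule matrix_inv_eq) (simp add: vec_eq_iff forall_2 matrix_matrix_mult_def sum_2 mat_def flip: of_real_mult)

lemma mpow_sm_diag: "mpow (sm a 0 1) s = sm (a powr s) 0 1"
  by (simp add: mpow_def mfun_sm_diag)

text \<open>The tilt of the eigenvectors of \<open>SG\<close> relative to that of \<open>B\<close>; for the quasi-arithmetic mean the tilt
  is \<open>\<alpha>\<close>, whatever \<open>q\<close> is.\<close>

definition sg_slope :: "real \<Rightarrow> real \<Rightarrow> real" where
  "sg_slope \<alpha> a = (a powr (2 * \<alpha>) - 1) / (a powr 2 - 1)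
     * ((a powr (\<alpha> - 1/2) - 1) / (a powr (2 * \<alpha> - 1) - 1)) * (1 + a powr (3/2 - \<alpha>))"

lemma jet_SGtilde:
  assumes c: "0 < c" "c < 1" and p: "0 < p" and \<alpha>: "\<alpha> \<noteq> 1/2"
  shows "jet (\<lambda>t. SGtilde \<alpha> p (sm c 0 1) (sm c t 1)) c (sg_slope \<alpha> (c powr p)) 1"
proof -
  define a where "a = c powr p"
  define \<kappa> where "\<kappa> = (a - 1) / (c - 1)"
  have a: "0 < a" "a < 1" using c p powr_less_mono2[of p c 1] by (auto simp: a_def)
  have ne1: "a powr s \<noteq> 1" if "s \<noteq> 0" for s
    using a that by (simp add: powr_def)
  have B: "jet (\<lambda>t. mpow (sm c t 1) p) a \<kappa> 1"
    by (rule jet_eq[OF jet_mpow[OF jet_offdiag]]) (use c in \<open>auto simp: a_def \<kappa>_def\<close>)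
  have A: "mpow (sm c 0 1) p = sm a 0 1" by (simp add: mpow_sm_diag a_def)
  have P: "mpow (matrix_inv (sm a 0 1)) (1/2) = sm (a powr (-1/2)) 0 1"
    and Q: "mpow (matrix_inv (sm a 0 1)) (-1/2) = sm (a powr (1/2)) 0 1"
    using a by (simp_all add: matrix_inv_sm_diag mpow_sm_diag powr_divide powr_minus_divide)
  have W: "jet (\<lambda>t. sm (a powr (1/2)) 0 1 ** mpow (sm c t 1) p ** sm (a powr (1/2)) 0 1)
      (a powr 2) (a powr (1/2) * \<kappa>) 1"
  proof (rule jet_eq[OF jet_sandwich[OF jet_const B]])
    have "a powr (1/2) * a powr (1/2) = a" using a by (simp flip: powr_add)
    then show "a powr (1/2) * a powr (1/2) * a = a powr 2"
      using a by (simp add: power2_eq_square)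
  qed auto
  define \<beta> where "\<beta> = (a powr (2 * \<alpha>) - 1) / (a powr 2 - 1)"
  have W\<alpha>: "jet (\<lambda>t. mpow (sm (a powr (1/2)) 0 1 ** mpow (sm c t 1) p ** sm (a powr (1/2)) 0 1) \<alpha>)
      (a powr (2 * \<alpha>)) (a powr (1/2) * \<kappa> * \<beta>) 1"
    by (rule jet_eq[OF jet_mpow[OF W]]) (use a ne1[of 2] in \<open>simp_all add: powr_powr \<beta>_def del: powr_numeral\<close>)
  have U: "jet (\<lambda>t. gmean \<alpha> (matrix_inv (sm a 0 1)) (mpow (sm c t 1) p))
      (a powr (2 * \<alpha> - 1)) (\<kappa> * \<beta>) 1"
    unfolding gmean_def P Q
  proof (rule jet_eq[OF jet_sandwich[OF jet_const W\<alpha>]])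
    show "a powr (-1/2) * a powr (-1/2) * a powr (2 * \<alpha>) = a powr (2 * \<alpha> - 1)"
      using a by (simp add: powr_diff flip: powr_add)
    have "a powr (-1/2) * a powr (1/2) = 1" using a by (simp flip: powr_add)
    then have "\<kappa> * \<beta> = (a powr (-1/2) * a powr (1/2)) * (\<kappa> * \<beta>)" by simp
    then show "a powr (-1/2) * 0 * a powr (2 * \<alpha>) + a powr (-1/2) * 1 * (a powr (1/2) * \<kappa> * \<beta>) + 0 * 1 * 1
        = \<kappa> * \<beta>" by (simp add: mult_ac)
  qed auto
  define \<gamma> where "\<gamma> = (a powr (\<alpha> - 1/2) - 1) / (a powr (2 * \<alpha> - 1) - 1)"
  have R: "jet (\<lambda>t. mpow (gmean \<alpha> (matrix_inv (sm a 0 1)) (mpow (sm c t 1) p)) (1/2))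
      (a powr (\<alpha> - 1/2)) (\<kappa> * \<beta> * \<gamma>) 1"
  proof -
    have e: "(a powr (2 * \<alpha> - 1)) powr (1/2) = a powr (\<alpha> - 1/2)"
      unfolding powr_powr by (simp add: field_simps)
    show ?thesis
      by (rule jet_eq[OF jet_mpow[OF U]])
        (use a \<alpha> ne1[of "2 * \<alpha> - 1"] in \<open>simp_all add: e \<gamma>_def\<close>)
  qed
  have F: "jet (\<lambda>t. Ftilde \<alpha> (sm a 0 1) (mpow (sm c t 1) p)) a (\<kappa> * sg_slope \<alpha> a) 1"
    unfolding Ftilde_def mpow_sm_diag
  proof (rule jet_eq[OF jet_sandwich[OF R jet_const]])
    have "\<alpha> - 1/2 + (\<alpha> - 1/2) + 2 * (1 - \<alpha>) = 1" "\<alpha> - 1/2 + 2 * (1 - \<alpha>) = 3/2 - \<alpha>" by simp_all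
    then have e: "a powr (\<alpha> - 1/2) * a powr (\<alpha> - 1/2) * a powr (2 * (1 - \<alpha>)) = a"
      "a powr (\<alpha> - 1/2) * a powr (2 * (1 - \<alpha>)) = a powr (3/2 - \<alpha>)"
      using a by (simp_all flip: powr_add)
    show "a powr (\<alpha> - 1/2) * a powr (\<alpha> - 1/2) * a powr (2 * (1 - \<alpha>)) = a" by (rule e)
    have "a powr (\<alpha> - 1/2) * (\<kappa> * \<beta> * \<gamma>) * a powr (2 * (1 - \<alpha>)) + \<kappa> * \<beta> * \<gamma>
        = \<kappa> * (\<beta> * \<gamma> * (1 + a powr (\<alpha> - 1/2) * a powr (2 * (1 - \<alpha>))))"
      by (simp add: algebra_simps)
    also have "\<dots> = \<kappa> * sg_slope \<alpha> a"
      unfolding e by (simp add: sg_slope_def \<beta>_def \<gamma>_def)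
    finally show "a powr (\<alpha> - 1/2) * (\<kappa> * \<beta> * \<gamma>) * a powr (2 * (1 - \<alpha>))
        + a powr (\<alpha> - 1/2) * 1 * 0 + \<kappa> * \<beta> * \<gamma> * 1 * 1 = \<kappa> * sg_slope \<alpha> a"
      by simp
  qed auto
  have ac: "a powr (1 / p) = c" using c p by (simp add: a_def powr_powr)
  show ?thesis
    unfolding SGtilde_def A a_def[symmetric]
    by (rule jet_eq[OF jet_mpow[OF F]]) (use a c in \<open>auto simp: ac \<kappa>_def\<close>)
qed

lemma jet_Amean:
  assumes c: "0 < c" "c < 1" and q: "0 < q"
  shows "jet (\<lambda>t. Amean \<alpha> q (sm c 0 1) (sm c t 1)) c \<alpha> 1"
proof -
  define b where "b = c powr q"
  have b: "0 < b" "b < 1" using c q powr_less_mono2[of q c 1] by (auto simp: b_def)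
  have B: "jet (\<lambda>t. mpow (sm c t 1) q) b ((b - 1) / (c - 1)) 1"
    by (rule jet_eq[OF jet_mpow[OF jet_offdiag]]) (use c in \<open>auto simp: b_def\<close>)
  have A: "jet (\<lambda>t. mpow (sm c 0 1) q) b 0 1"
    unfolding mpow_sm_diag b_def by (rule jet_const)
  have M: "jet (\<lambda>t. (1 - \<alpha>) *\<^sub>R mpow (sm c 0 1) q + \<alpha> *\<^sub>R mpow (sm c t 1) q) b
      (\<alpha> * (b - 1) / (c - 1)) 1"
    by (rule jet_eq[OF jet_linear[OF A B]]) (auto simp: algebra_simps)
  have bc: "b powr (1 / q) = c" using c q by (simp add: b_def powr_powr)
  show ?thesis
    unfolding Amean_def
    by (rule jet_eq[OF jet_mpow[OF M]]) (use b c in \<open>auto simp: bc\<close>)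
qed

lemma sg_slope_at_0:
  assumes "0 < \<alpha>" "\<alpha> < 1" "\<alpha> \<noteq> 1/2"
  shows "((sg_slope \<alpha>) \<longlongrightarrow> (if \<alpha> < 1/2 then 0 else 1)) (at_right 0)"
proof (cases "\<alpha> < 1/2")
  case True
  then show ?thesis using assms unfolding sg_slope_def by simp real_asymp
next
  case False
  then have "1/2 < \<alpha>" using assms by simp
  then show ?thesis using assms unfolding sg_slope_def by simp real_asymp
qed

lemma sg_slope_neq:
  assumes "0 < \<alpha>" "\<alpha> < 1" "\<alpha> \<noteq> 1/2"
  obtains a where "0 < a" "a < 1" "sg_slope \<alpha> a \<noteq> \<alpha>"
proof -
  have "(if \<alpha> < 1/2 then 0 else 1) \<noteq> \<alpha>" using assms by auto
  then have "\<forall>\<^sub>F a in at_right 0. sg_slope \<alpha> a \<noteq> \<alpha>"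
    by (rule tendsto_imp_eventually_ne[OF sg_slope_at_0[OF assms]])
  moreover have "\<forall>\<^sub>F a in at_right (0::real). 0 < a \<and> a < 1"
    using eventually_at_right_real[of 0 1] by simp
  ultimately have "\<forall>\<^sub>F a in at_right 0. sg_slope \<alpha> a \<noteq> \<alpha> \<and> 0 < a \<and> a < 1"
    by eventually_elim simp
  then obtain a where "sg_slope \<alpha> a \<noteq> \<alpha> \<and> 0 < a \<and> a < 1"
    using eventually_happens'[OF trivial_limit_at_right_real] by blast
  then show ?thesis using that by blast
qed

lemma counterexample_off_half:
  assumes \<alpha>: "0 < \<alpha>" "\<alpha> < 1" "\<alpha> \<noteq> 1/2" and p: "0 < p" and q: "0 < q"
    and R: "R = near_le \<or> R = chao_le"
  shows "\<exists>A B :: complex^2^2. posdef A \<and> posdef B \<and> \<not> R (SGtilde \<alpha> p A B) (Amean \<alpha> q A B)"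
proof -
  obtain a where a: "0 < a" "a < 1" "sg_slope \<alpha> a \<noteq> \<alpha>"
    using sg_slope_neq \<alpha> by blast
  define c where "c = a powr (1 / p)"
  have c: "0 < c" "c < 1" using a p powr_less_mono2[of "1 / p" a 1] by (auto simp: c_def)
  have ca: "c powr p = a" using a p by (simp add: c_def powr_powr)
  have S: "jet (\<lambda>t. SGtilde \<alpha> p (sm c 0 1) (sm c t 1)) c (sg_slope \<alpha> a) 1"
    using jet_SGtilde[OF c p \<alpha>(3)] by (simp add: ca)
  have M: "jet (\<lambda>t. Amean \<alpha> q (sm c 0 1) (sm c t 1)) c \<alpha> 1"
    by (rule jet_Amean[OF c q])
  have "c \<noteq> 1" using c by simp
  then have "\<not> (\<forall>\<^sub>F t in nhds 0. R (SGtilde \<alpha> p (sm c 0 1) (sm c t 1)) (Amean \<alpha> q (sm c 0 1) (sm c t 1)))"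
    using R a(3) jet_near_le[OF S M c(1)] jet_chao_le[OF S M c(1)] by blast
  moreover have "\<forall>\<^sub>F t in nhds 0. spd (sm c t 1)"
    using c by (intro jet_spd[OF jet_offdiag]) auto
  ultimately obtain t where "\<not> R (SGtilde \<alpha> p (sm c 0 1) (sm c t 1)) (Amean \<alpha> q (sm c 0 1) (sm c t 1))"
    and "spd (sm c t 1)"
    by (metis (mono_tags, lifting) eventually_mono)
  moreover have "spd (sm c 0 1)" using c by (simp add: spd_sm)
  ultimately show ?thesis using posdef_spd by blast
qed

section \<open>Failure of the chaotic order at the midpoint\<close>

lemma isCont_powr_pos:
  fixes r :: real
  assumes "0 < r"
  shows "isCont (\<lambda>x. x powr r) x"
proof (cases "x = 0")
  case True
  have "((\<lambda>x. \<bar>x\<bar> powr r) \<longlongrightarrow> \<bar>0\<bar> powr r) (at (0::real))"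
    by (rule tendsto_powr'[OF _ tendsto_const]) (use assms in \<open>auto intro!: tendsto_eq_intros\<close>)
  moreover have "\<bar>x\<bar> powr r = x powr r" for x :: real
    by (simp add: powr_def abs_if ln_minus)
  ultimately show ?thesis using True by (simp add: isCont_def)
next
  case False
  then show ?thesis by (intro continuous_intros) auto
qed

lemma tendsto_sm:
  assumes "(x \<longlongrightarrow> x0) F" "(y \<longlongrightarrow> y0) F" "(z \<longlongrightarrow> z0) F"
  shows "((\<lambda>t. sm (x t) (y t) (z t)) \<longlongrightarrow> sm x0 y0 z0) F"
proof (rule vec_tendstoI, rule vec_tendstoI)
  fix i j :: 2
  show "((\<lambda>t. sm (x t) (y t) (z t) $ i $ j) \<longlongrightarrow> sm x0 y0 z0 $ i $ j) F"
    using assms unfolding sm_def by (auto intro!: tendsto_of_real)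
qed

lemma tendsto_mfun:
  assumes M: "(M \<longlongrightarrow> sm x0 y0 z0) F" and sm: "\<And>t. \<exists>x y z. M t = sm x y z"
    and gap: "egap x0 y0 z0 \<noteq> 0" and f: "isCont f (ehi x0 y0 z0)" "isCont f (elo x0 y0 z0)"
  shows "((\<lambda>t. mfun f (M t)) \<longlongrightarrow> mfun f (sm x0 y0 z0)) F"
proof -
  obtain x y z where M': "\<And>t. M t = sm (x t) (y t) (z t)"
    using sm by metis
  have e: "((\<lambda>t. Re (M t $ i $ j)) \<longlongrightarrow> Re (sm x0 y0 z0 $ i $ j)) F" for i j
    by (intro tendsto_intros M)
  have lim: "(x \<longlongrightarrow> x0) F" "(y \<longlongrightarrow> y0) F" "(z \<longlongrightarrow> z0) F"
    using e[of 1 1] e[of 1 2] e[of 2 2] by (simp_all add: M')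
  have g: "((\<lambda>t. egap (x t) (y t) (z t)) \<longlongrightarrow> egap x0 y0 z0) F"
    unfolding egap_def by (intro tendsto_intros lim) simp
  have hl: "((\<lambda>t. f (ehi (x t) (y t) (z t))) \<longlongrightarrow> f (ehi x0 y0 z0)) F"
    "((\<lambda>t. f (elo (x t) (y t) (z t))) \<longlongrightarrow> f (elo x0 y0 z0)) F"
    by (rule isCont_tendsto_compose[OF f(1)] isCont_tendsto_compose[OF f(2)];
        intro tendsto_intros lim g; simp)+
  show ?thesis
    unfolding M' mfun_sm by (intro tendsto_sm tendsto_intros hl g lim) (use gap in auto)
qed

lemma ex_mfun_sm: "\<exists>x' y' z'. mfun f (sm x y z) = sm x' y' z'"
  by (simp add: mfun_sm)

lemma mpow_rank_one:
  assumes "a\<^sup>2 + b\<^sup>2 = 1" "0 < l" "0 < r"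
  shows "mpow (sm (l * a\<^sup>2) (l * (a * b)) (l * b\<^sup>2)) r = sm (l powr r * a\<^sup>2) (l powr r * (a * b)) (l powr r * b\<^sup>2)"
    and "egap (l * a\<^sup>2) (l * (a * b)) (l * b\<^sup>2) = l / 2"
proof -
  have "((l * a\<^sup>2 - l * b\<^sup>2) / 2)\<^sup>2 + (l * (a * b))\<^sup>2 = (l * (a\<^sup>2 + b\<^sup>2) / 2)\<^sup>2"
    by (simp add: power2_eq_square field_simps)
  then show g: "egap (l * a\<^sup>2) (l * (a * b)) (l * b\<^sup>2) = l / 2"
    using assms by (simp add: egap_def)
  have m: "(l * a\<^sup>2 + l * b\<^sup>2) / 2 = l / 2"
    using assms by (simp flip: distrib_left)
  have b: "b\<^sup>2 = 1 - a\<^sup>2" using assms by simp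
  show "mpow (sm (l * a\<^sup>2) (l * (a * b)) (l * b\<^sup>2)) r = sm (l powr r * a\<^sup>2) (l powr r * (a * b)) (l powr r * b\<^sup>2)"
    unfolding mpow_def mfun_sm g m using assms by (simp add: b) (simp add: field_simps)
qed

text \<open>Half the sum of the rank-one matrices \<open>u v v\<^sup>T\<close> and \<open>(K / u) w w\<^sup>T\<close>, where \<open>v, w\<close> are the unit vectors along
  \<open>(1, -2)\<close> and \<open>(4, 1)\<close>. Its determinant does not depend on \<open>u\<close>; as \<open>u\<close> grows, its logarithm has eigenvalues
  \<open>\<plusminus> ln u + O(1)\<close>, and \<open>e\<^sub>1\<close> is closer to the small eigendirection because \<open>\<langle>e\<^sub>1, v\<rangle>\<^sup>2 = 1/5 < 1/2\<close>.\<close>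

definition rank_one_sum :: "real \<Rightarrow> real \<Rightarrow> complex^2^2" where
  "rank_one_sum K u =
    sm (u / 10 + 8 * (K / u) / 17) (2 * (K / u) / 17 - u / 5) (2 * u / 5 + K / u / 34)"

lemma rank_one_sum_log_neg:
  fixes K :: real
  assumes K: "0 < K"
  shows "\<exists>u>0. spd (rank_one_sum K u)
    \<and> Re (mlog (rank_one_sum K u) $ 1 $ 1) < 0"
proof -
  define D where "D = 81 / 340 * K"
  define x y z where "x u = u / 10 + 8 * (K / u) / 17" and "y u = 2 * (K / u) / 17 - u / 5"
    and "z u = 2 * u / 5 + K / u / 34" for u
  define g where "g u = sqrt (((u + K / u) / 4)\<^sup>2 - D)" for u
  define h where "h u = (u + K / u) / 4 + g u" for u
  have D: "0 < D" using K by (simp add: D_def)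
  have det: "x u * z u - (y u)\<^sup>2 = D" if "0 < u" for u
    using that by (simp add: x_def y_def z_def D_def power2_eq_square field_simps)
  have spd: "spd (sm (x u) (y u) (z u))" if "0 < u" for u
    using det[OF that] D K that by (auto simp: spd_sm x_def intro!: add_pos_pos)
  have "\<forall>\<^sub>F u in at_top. ln D / 2 + (2 * ln (h u) - ln D) * ((x u - z u) / (4 * g u)) < 0"
  proof -
    have "filterlim (\<lambda>u. h u) at_top at_top"
      using K D unfolding h_def g_def by real_asymp
    then have "filterlim (\<lambda>u. ln (h u)) at_top at_top"
      by (rule filterlim_compose[OF ln_at_top])
    then have "filterlim (\<lambda>u. - ln D + 2 * ln (h u)) at_top at_top"
      by (intro filterlim_tendsto_add_at_top filterlim_tendsto_pos_mult_at_top tendsto_const) auto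
    moreover have "((\<lambda>u. (x u - z u) / (4 * g u)) \<longlongrightarrow> - 3 / 10) at_top"
      using K D unfolding g_def x_def z_def by real_asymp
    ultimately have "filterlim (\<lambda>u. (x u - z u) / (4 * g u) * (- ln D + 2 * ln (h u))) at_bot at_top"
      by (intro filterlim_tendsto_neg_mult_at_bot) auto
    then have "\<forall>\<^sub>F u in at_top. (x u - z u) / (4 * g u) * (- ln D + 2 * ln (h u)) < - (ln D / 2)"
      by (simp add: filterlim_at_bot_dense)
    then show ?thesis by eventually_elim (simp add: mult.commute)
  qed
  then have "\<forall>\<^sub>F u in at_top. 0 < u \<and> ln D / 2 + (2 * ln (h u) - ln D) * ((x u - z u) / (4 * g u)) < 0"
    using eventually_gt_at_top[of 0] by eventually_elim simp
  then obtain u where u: "0 < u" and neg: "ln D / 2 + (2 * ln (h u) - ln D) * ((x u - z u) / (4 * g u)) < 0"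
    using eventually_happens'[OF trivial_limit_at_top_linorder] by blast
  have xyz: "0 < x u" "(y u)\<^sup>2 < x u * z u" using spd[OF u] by (simp_all add: spd_sm)
  note pos = ehi_elo_pos[OF xyz]
  have m: "(x u + z u) / 2 = (u + K / u) / 4"
    by (simp add: x_def z_def field_simps)
  have "(egap (x u) (y u) (z u))\<^sup>2 = ((x u + z u) / 2)\<^sup>2 - (x u * z u - (y u)\<^sup>2)"
    unfolding egap_power2 by (simp add: power2_eq_square field_simps)
  then have gap2: "(egap (x u) (y u) (z u))\<^sup>2 = ((u + K / u) / 4)\<^sup>2 - D"
    unfolding det[OF u] m .
  then have gap: "egap (x u) (y u) (z u) = g u"
    unfolding g_def by (metis egap_def real_sqrt_ge_zero real_sqrt_unique sum_power2_ge_zero)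
  have "ehi (x u) (y u) (z u) * elo (x u) (y u) (z u) = ((u + K / u) / 4)\<^sup>2 - (egap (x u) (y u) (z u))\<^sup>2"
    unfolding m by (simp add: power2_eq_square algebra_simps)
  then have "ehi (x u) (y u) (z u) * elo (x u) (y u) (z u) = D"
    unfolding gap2 by simp
  then have lo: "ln (elo (x u) (y u) (z u)) = ln D - ln (h u)"
    using ln_mult_pos[OF pos] by (simp add: h_def m gap)
  have hi: "ehi (x u) (y u) (z u) = h u"
    by (simp add: h_def m gap)
  have "Re (mlog (sm (x u) (y u) (z u)) $ 1 $ 1) = ln D / 2 + (2 * ln (h u) - ln D) * ((x u - z u) / (4 * g u))"
    unfolding mlog_def mfun_sm gap lo[unfolded gap] hi[unfolded gap] by simp
  moreover have "rank_one_sum K u = sm (x u) (y u) (z u)"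
    by (simp only: rank_one_sum_def x_def y_def z_def)
  ultimately show ?thesis using neg spd[OF u] u by auto
qed

lemma counterexample_half:
  assumes p: "0 < p" and q: "0 < q"
  shows "\<exists>A B :: complex^2^2. posdef A \<and> posdef B \<and>
    \<not> chao_le (SGtilde (1/2) p A B) (Amean (1/2) q A B)"
proof -
  define r where "r = q / p"
  have r: "0 < r" using p q by (simp add: r_def)
  define K where "K = (85 / 4) powr r"
  have K: "0 < K" by (simp add: K_def)
  from rank_one_sum_log_neg[OF K] obtain u where u: "0 < u"
    and spd0: "spd (rank_one_sum K u)"
    and neg0: "Re (mlog (rank_one_sum K u) $ 1 $ 1) < 0"
    by blast
  define n where "n = u powr (1 / r) / 5"
  have n: "0 < n" using u by (simp add: n_def)
  define c where "c = 1 / sqrt n"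
  have c: "0 < c" "c * c = 1 / n" "1 / c * (1 / c) = n" using n by (simp_all add: c_def)
  define V where "V = sm (2 * c) (c / 2) (c / 4)"
  define W where "W = sm (1 / c) (- 2 / c) (8 / c)"
  have VW: "V ** W = mat 1" "W ** V = mat 1"
    using c by (simp_all add: V_def W_def vec_eq_iff forall_2 matrix_matrix_mult_def sum_2 mat_def)
  have spdVW: "spd V" "spd W"
    using c n by (simp_all add: V_def W_def spd_sm power2_eq_square field_simps)
  define A' where "A' e = W ** sm 1 0 e ** W" for e
  define B' where "B' e = V ** sm 1 0 e ** V" for e
  define A where "A e = mpow (A' e) (1 / p)" for e
  define B where "B e = mpow (B' e) (1 / p)" for e
  define M where "M e = (1/2) *\<^sub>R mpow (A' e) r + (1/2) *\<^sub>R mpow (B' e) r" for e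
  have sms: "\<exists>x y z. A' e = sm x y z" "\<exists>x y z. B' e = sm x y z" for e
    by (simp_all add: A'_def B'_def W_def V_def sm_sandwich)
  have smp: "\<exists>x y z. mpow (A' e) s = sm x y z" "\<exists>x y z. mpow (B' e) s = sm x y z" for e s
    using sms[of e] ex_mfun_sm unfolding mpow_def by metis+
  have smM: "\<exists>x y z. M e = sm x y z" for e
    using smp[of e r] unfolding M_def by (auto simp: sm_linear)
  have A'_eq: "A' e = sm (n * (1 + 4 * e)) (n * (- 2 - 16 * e)) (n * (4 + 64 * e))" for e
    unfolding A'_def W_def sm_sandwich c(3)[symmetric] using c(1) by (simp add: field_simps)
  have B'_eq: "B' e = sm (1 / n * (4 + e / 4)) (1 / n * (1 + e / 8)) (1 / n * (1 / 4 + e / 16))" for e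
    unfolding B'_def V_def sm_sandwich c(2)[symmetric] by (simp add: field_simps)
  have main: "Re (mlog (M e) $ 1 $ 1) \<ge> 0"
    if e: "0 < e" and le: "chao_le (SGtilde (1/2) p (A e) (B e)) (Amean (1/2) q (A e) (B e))" for e
  proof -
    have F: "spd (sm 1 0 e)" using e by (simp add: spd_sm)
    have A': "spd (A' e)" "spd (B' e)" unfolding A'_def B'_def by (intro spd_sandwich spdVW F)+
    have "V ** V ** A' e ** V ** V = V ** (V ** W) ** sm 1 0 e ** (W ** V) ** V"
      by (simp add: A'_def matrix_mul_assoc)
    then have B'A': "B' e = V ** V ** A' e ** V ** V" by (simp add: VW B'_def)
    have "V ** A' e ** V = (V ** W) ** sm 1 0 e ** (W ** V)"
      by (simp add: A'_def matrix_mul_assoc)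
    then have "Ftilde (1/2) (A' e) (B' e) = sm 1 0 e"
      unfolding B'A' using Ftilde_half[OF A'(1) spdVW(1)] by (simp add: VW)
    then have "SGtilde (1/2) p (A e) (B e) = mpow (sm 1 0 e) (1 / p)"
      using A' p by (simp add: SGtilde_def A_def B_def mpow_mpow mpow_1)
    then have S: "mlog (SGtilde (1/2) p (A e) (B e)) = (1 / p) *\<^sub>R sm 0 0 (ln e)"
      using mfun_sm_diag[of ln 1 e] by (simp add: mlog_mpow_sm) (simp add: mlog_def)
    have "Amean (1/2) q (A e) (B e) = mpow (M e) (1 / q)"
      using A' by (simp add: Amean_def A_def B_def M_def mpow_mpow r_def)
    then have Y: "mlog (Amean (1/2) q (A e) (B e)) = (1 / q) *\<^sub>R mlog (M e)"
      using smM[of e] by (auto simp: mlog_mpow_sm)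
    obtain x y z where xyz: "mlog (M e) = sm x y z"
      using smM[of e] ex_mfun_sm unfolding mlog_def by metis
    have "possemidef ((1 / q) *\<^sub>R sm x y z - (1 / p) *\<^sub>R sm 0 0 (ln e))"
      using le by (simp add: chao_le_def loewner_le_def S Y xyz)
    then have "possemidef (sm (x / q) (y / q) (z / q - ln e / p))"
      using sm_linear[of "1 / q" x y z "- (1 / p)" 0 0 "ln e"] by simp
    then have "0 \<le> x / q" by (rule possemidef_smD)
    then show ?thesis using q by (simp add: xyz zero_le_divide_iff)
  qed
  have lim: "((\<lambda>e. mlog (M e)) \<longlongrightarrow> mlog (rank_one_sum K u)) (at_right 0)"
  proof -
    have nu: "(5 * n) powr r = u" using u r by (simp add: n_def powr_powr)
    have nK: "(17 / 4 * (1 / n)) powr r = K / u"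
    proof -
      have "17 / 4 * (1 / n) = (85 / 4) / (5 * n)" using n by simp
      then show ?thesis using nu by (simp only: K_def powr_divide)
    qed
    have lA: "((\<lambda>e. mpow (A' e) r) \<longlongrightarrow> sm (u * (1/5)) (u * (- 2/5)) (u * (4/5))) (at_right 0)"
    proof -
      let ?a = "sqrt (1/5) :: real" and ?b = "- (2 * sqrt (1/5)) :: real"
      have sq: "?a\<^sup>2 = 1/5" "?a * ?b = - 2/5" "?b\<^sup>2 = 4/5"
        by (simp_all add: power_mult_distrib)
      have ab: "?a\<^sup>2 + ?b\<^sup>2 = 1" unfolding sq by simp
      have n5: "0 < 5 * n" using n by simp
      note R = mpow_rank_one[OF ab n5 r, unfolded sq nu]
      have "((\<lambda>e. A' e) \<longlongrightarrow> sm (5 * n * (1/5)) (5 * n * (- 2/5)) (5 * n * (4/5))) (at_right 0)"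
        unfolding A'_eq by (rule tendsto_sm) (use n in \<open>auto intro!: tendsto_eq_intros\<close>)
      then have "((\<lambda>e. mfun (\<lambda>x. x powr r) (A' e)) \<longlongrightarrow>
          mfun (\<lambda>x. x powr r) (sm (5 * n * (1/5)) (5 * n * (- 2/5)) (5 * n * (4/5)))) (at_right 0)"
        by (rule tendsto_mfun[OF _ sms(1)]) (use R(2) n isCont_powr_pos[OF r] in auto)
      then show ?thesis using R(1) by (simp add: mpow_def)
    qed
    have lB: "((\<lambda>e. mpow (B' e) r) \<longlongrightarrow> sm (K / u * (16/17)) (K / u * (4/17)) (K / u * (1/17))) (at_right 0)"
    proof -
      let ?a = "4 * sqrt (1/17) :: real" and ?b = "sqrt (1/17) :: real"
      have sq: "?a\<^sup>2 = 16/17" "?a * ?b = 4/17" "?b\<^sup>2 = 1/17"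
        by (simp_all add: power_mult_distrib)
      have ab: "?a\<^sup>2 + ?b\<^sup>2 = 1" unfolding sq by simp
      have n17: "0 < 17 / 4 * (1 / n)" using n by simp
      note R = mpow_rank_one[OF ab n17 r, unfolded sq nK]
      have "((\<lambda>e. B' e) \<longlongrightarrow> sm (17 / 4 * (1 / n) * (16/17)) (17 / 4 * (1 / n) * (4/17))
          (17 / 4 * (1 / n) * (1/17))) (at_right 0)"
        unfolding B'_eq by (rule tendsto_sm) (use n in \<open>auto intro!: tendsto_eq_intros\<close>)
      then have "((\<lambda>e. mfun (\<lambda>x. x powr r) (B' e)) \<longlongrightarrow>
          mfun (\<lambda>x. x powr r) (sm (17 / 4 * (1 / n) * (16/17)) (17 / 4 * (1 / n) * (4/17))
          (17 / 4 * (1 / n) * (1/17)))) (at_right 0)"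
        by (rule tendsto_mfun[OF _ sms(2)]) (use R(2) n isCont_powr_pos[OF r] in auto)
      then show ?thesis using R(1) by (simp add: mpow_def)
    qed
    let ?x = "u / 10 + 8 * (K / u) / 17" and ?y = "2 * (K / u) / 17 - u / 5"
      and ?z = "2 * u / 5 + K / u / 34"
    have "(M \<longlongrightarrow> (1/2) *\<^sub>R sm (u * (1/5)) (u * (- 2/5)) (u * (4/5))
        + (1/2) *\<^sub>R sm (K / u * (16/17)) (K / u * (4/17)) (K / u * (1/17))) (at_right 0)"
      unfolding M_def by (intro tendsto_intros lA lB)
    moreover have "(1/2) *\<^sub>R sm (u * (1/5)) (u * (- 2/5)) (u * (4/5))
        + (1/2) *\<^sub>R sm (K / u * (16/17)) (K / u * (4/17)) (K / u * (1/17)) = sm ?x ?y ?z"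
      unfolding sm_linear by simp
    ultimately have lM: "(M \<longlongrightarrow> sm ?x ?y ?z) (at_right 0)" by simp
    have pos: "0 < ?x" "?y\<^sup>2 < ?x * ?z" using spd0 by (simp_all add: rank_one_sum_def spd_sm)
    have gap: "egap ?x ?y ?z \<noteq> 0"
    proof
      assume "egap ?x ?y ?z = 0"
      then have "?x = ?z" "?y = 0"
        by (simp_all add: egap_def sum_power2_eq_zero_iff)
      then have "K * 25 = K * 10" using u by (simp add: field_simps)
      then show False using K by simp
    qed
    show ?thesis
      unfolding mlog_def rank_one_sum_def using ehi_elo_pos[OF pos]
      by (intro tendsto_mfun[OF lM smM gap] isCont_ln) auto
  qed
  have "((\<lambda>e. Re (mlog (M e) $ 1 $ 1)) \<longlongrightarrow> Re (mlog (rank_one_sum K u) $ 1 $ 1)) (at_right 0)"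
    by (intro tendsto_intros lim)
  then have "\<forall>\<^sub>F e in at_right 0. Re (mlog (M e) $ 1 $ 1) < 0"
    using neg0 by (rule order_tendstoD)
  moreover have "\<forall>\<^sub>F e in at_right (0::real). 0 < e"
    by (rule eventually_at_right_less)
  ultimately have "\<forall>\<^sub>F e in at_right 0. Re (mlog (M e) $ 1 $ 1) < 0 \<and> 0 < e"
    by eventually_elim simp
  then obtain e where e: "Re (mlog (M e) $ 1 $ 1) < 0" "0 < e"
    using eventually_happens'[OF trivial_limit_at_right_real] by blast
  have "spd (sm 1 0 e)" using e by (simp add: spd_sm)
  then have "spd (A e)" "spd (B e)"
    unfolding A_def B_def A'_def B'_def by (intro spd_mpow spd_sandwich spdVW; assumption)+
  moreover have "\<not> chao_le (SGtilde (1/2) p (A e) (B e)) (Amean (1/2) q (A e) (B e))"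
    using main e by force
  ultimately show ?thesis using posdef_spd by blast
qed

theorem theorem4p32:
  shows "(\<forall>\<alpha> p q :: real. 0 < \<alpha> \<and> \<alpha> < 1 \<and> \<alpha> \<noteq> 1/2 \<and> 0 < p \<and> 0 < q \<longrightarrow>
            (\<exists>A B :: complex^2^2. posdef A \<and> posdef B \<and>
               \<not> near_le (SGtilde \<alpha> p A B) (Amean \<alpha> q A B)))
       \<and> (\<forall>\<alpha> p q :: real. 0 < \<alpha> \<and> \<alpha> < 1 \<and> 0 < p \<and> 0 < q \<longrightarrow>
            (\<exists>A B :: complex^2^2. posdef A \<and> posdef B \<and>
               \<not> chao_le (SGtilde \<alpha> p A B) (Amean \<alpha> q A B)))"
proof (intro conjI allI impI; elim conjE)
  fix \<alpha> p q :: real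
  assume "0 < \<alpha>" "\<alpha> < 1" "\<alpha> \<noteq> 1/2" "0 < p" "0 < q"
  then show "\<exists>A B :: complex^2^2. posdef A \<and> posdef B \<and>
      \<not> near_le (SGtilde \<alpha> p A B) (Amean \<alpha> q A B)"
    by (intro counterexample_off_half) auto
next
  fix \<alpha> p q :: real
  assume *: "0 < \<alpha>" "\<alpha> < 1" "0 < p" "0 < q"
  show "\<exists>A B :: complex^2^2. posdef A \<and> posdef B \<and>
      \<not> chao_le (SGtilde \<alpha> p A B) (Amean \<alpha> q A B)"
  proof (cases "\<alpha> = 1/2")
    case True
    show ?thesis unfolding True by (rule counterexample_half[OF *(3,4)])
  next
    case False
    then show ?thesis using * by (intro counterexample_off_half) auto
  qed
qed

end
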